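(* Let $\mathcal{H}$ be a complex Hilbert space with orthonormal basis $\{e_I : I \in \mathbb{N}^3\}$. Set $a_{2,1} = -1$ and $a_{1,2} = a_{1,3} = a_{2,3} = a_{3,1} = a_{3,2} = 1$. Let $T = (T_1,T_2,T_3)$ be the tuple of bounded operators on $\mathcal{H}$ with $T_j e_I = w_{I,j} e_{I+\varepsilon_j}$ for $I \in \mathbb{N}^3$, $j \in \{1,2,3\}$, where $w_{I,j} = a_{i,j}$ if $I = \varepsilon_i$ with $i \in \{1,2,3\}$, $i \ne j$, and $w_{I,j} = 0$ in all other cases (that is, if $I = (0,0,0)$, or $I = \varepsilon_j$, or $|I| \ge 2$). Then $T_1,T_2,T_3$ are commuting contractions, and $(T_1,T_2,T_3)$ does not dilate to a $3$-tuple of commuting unitaries.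
   Context: $\mathbb{N} = \{0,1,2,\ldots\}$; for $I = (i_1,i_2,i_3) \in \mathbb{N}^3$, $|I| = i_1+i_2+i_3$; $\varepsilon_j \in \mathbb{N}^3$ is the multi-index whose $j$-th coordinate is $1$ and whose other coordinates are $0$. A contraction is an operator of norm at most $1$. Dilation: a $d$-tuple $(T_1,\ldots,T_d)$ of commuting operators on $\mathcal{H}$ dilates to a $d$-tuple of commuting unitaries if there are a Hilbert space $\mathcal{K}$ containing $\mathcal{H}$ as a closed subspace and commuting unitary operators $U_1,\ldots,U_d$ on $\mathcal{K}$ such that $p(T_1,\ldots,T_d) = P_{\mathcal{H}}\, p(U_1,\ldots,U_d)|_{\mathcal{H}}$ for all $p \in \mathbb{C}[z_1,\ldots,z_d]$, where $P_{\mathcal{H}}$ is the orthogonal projection of $\mathcal{K}$ onto $\mathcal{H}$. *)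

theory Defs
  imports "HOL-Analysis.Analysis" "HOL-Library.Poly_Mapping"
begin

text \<open>The inner product is linear in its first argument. Extending
  \<^class>\<open>real_normed_vector\<close> provides the topology and the restriction to real scalars.\<close>

class complex_inner = real_normed_vector +
  fixes scaleC :: "complex \<Rightarrow> 'a \<Rightarrow> 'a"  (infixr \<open>*\<^sub>C\<close> 75)
    and cinner :: "'a \<Rightarrow> 'a \<Rightarrow> complex"
  assumes scaleC_add_right: "c *\<^sub>C (x + y) = c *\<^sub>C x + c *\<^sub>C y"
    and scaleC_add_left: "(c + d) *\<^sub>C x = c *\<^sub>C x + d *\<^sub>C x"
    and scaleC_scaleC: "c *\<^sub>C (d *\<^sub>C x) = (c * d) *\<^sub>C x"
    and scaleC_of_real: "complex_of_real r *\<^sub>C x = r *\<^sub>R x"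
    and cinner_commute: "cinner x y = cnj (cinner y x)"
    and cinner_add_left: "cinner (x + y) z = cinner x z + cinner y z"
    and cinner_scaleC_left: "cinner (c *\<^sub>C x) y = c * cinner x y"
    and cinner_self: "cinner x x = complex_of_real ((norm x)\<^sup>2)"

class chilbert_space = complex_inner + complete_space

instantiation complex :: chilbert_space
begin

definition scaleC_complex :: "complex \<Rightarrow> complex \<Rightarrow> complex"
  where "scaleC_complex c x = c * x"

definition cinner_complex :: "complex \<Rightarrow> complex \<Rightarrow> complex"
  where "cinner_complex x y = x * cnj y"

instance
  by standard
    (simp_all add: scaleC_complex_def cinner_complex_def algebra_simps scaleR_conv_of_real
      complex_norm_square del: of_real_power)

end

definition orthonormal_basis :: "('i \<Rightarrow> 'a::complex_inner) \<Rightarrow> bool"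
  where "orthonormal_basis e \<longleftrightarrow>
    (\<forall>i j. cinner (e i) (e j) = (if i = j then 1 else 0)) \<and>
    closure (module.span (*\<^sub>C) (range e)) = UNIV"

definition bounded_clinear :: "('a::complex_inner \<Rightarrow> 'b::complex_inner) \<Rightarrow> bool"
  where "bounded_clinear f \<longleftrightarrow> bounded_linear f \<and> (\<forall>c x. f (c *\<^sub>C x) = c *\<^sub>C f x)"

definition contraction :: "('a::complex_inner \<Rightarrow> 'a) \<Rightarrow> bool"
  where "contraction f \<longleftrightarrow> bounded_clinear f \<and> onorm f \<le> 1"

definition unitary :: "('a::complex_inner \<Rightarrow> 'a) \<Rightarrow> bool"
  where "unitary U \<longleftrightarrow>
    bounded_clinear U \<and> surj U \<and> (\<forall>x y. cinner (U x) (U y) = cinner x y)"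

definition commuting :: "('d \<Rightarrow> 'a \<Rightarrow> 'a) \<Rightarrow> bool"
  where "commuting T \<longleftrightarrow> (\<forall>i j. T i \<circ> T j = T j \<circ> T i)"

definition isometric_embedding :: "('a::complex_inner \<Rightarrow> 'b::complex_inner) \<Rightarrow> bool"
  where "isometric_embedding V \<longleftrightarrow>
    bounded_clinear V \<and> (\<forall>x y. cinner (V x) (V y) = cinner x y)"

definition orthogonal_projection_onto :: "'a::complex_inner set \<Rightarrow> ('a \<Rightarrow> 'a) \<Rightarrow> bool"
  where "orthogonal_projection_onto M P \<longleftrightarrow>
    (\<forall>x. P x \<in> M \<and> (\<forall>y\<in>M. cinner (x - P x) y = 0))"

text \<open>The factors are composed in increasing order of the index; for commuting tuples, the only
  case of interest, the order is irrelevant.\<close>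

definition monomial_op :: "('d::{finite,linorder} \<Rightarrow> 'a \<Rightarrow> 'a) \<Rightarrow> (nat, 'd) vec \<Rightarrow> 'a \<Rightarrow> 'a"
  where "monomial_op T I = foldr (\<lambda>j S. (T j ^^ (I $ j)) \<circ> S) (sorted_list_of_set UNIV) id"

text \<open>A polynomial in variables indexed by \<open>'d\<close> is the finitely supported family of its
  coefficients, indexed by the exponents.\<close>

definition poly_op ::
    "((nat, 'd) vec \<Rightarrow>\<^sub>0 complex) \<Rightarrow> ('d::{finite,linorder} \<Rightarrow> 'a \<Rightarrow> 'a) \<Rightarrow> 'a \<Rightarrow> 'a::complex_inner"
  where "poly_op p T x = (\<Sum>I\<in>Poly_Mapping.keys p. Poly_Mapping.lookup p I *\<^sub>C monomial_op T I x)"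

text \<open>The inclusion of \<open>H\<close> into \<open>K\<close> is an isometric embedding \<open>V\<close>; by completeness of \<open>H\<close> its
  range is closed. The type argument is the space \<open>K\<close>: that \<open>T\<close> does not dilate is expressed by
  the negation for an arbitrary type \<open>'k\<close>.\<close>

definition dilates_to_commuting_unitaries ::
    "'k::chilbert_space itself \<Rightarrow> ('d::{finite,linorder} \<Rightarrow> 'h \<Rightarrow> 'h::chilbert_space) \<Rightarrow> bool"
  where "dilates_to_commuting_unitaries K T \<longleftrightarrow>
    (\<exists>(V :: 'h \<Rightarrow> 'k) (P :: 'k \<Rightarrow> 'k) (U :: 'd \<Rightarrow> 'k \<Rightarrow> 'k).
      isometric_embedding V \<and> orthogonal_projection_onto (range V) P \<and>
      (\<forall>j. unitary (U j)) \<and> commuting U \<and>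
      (\<forall>p h. V (poly_op p T h) = P (poly_op p U (V h))))"

text \<open>The index type \<^typ>\<open>3\<close> has exactly the elements \<open>1\<close>, \<open>2\<close> and \<open>3\<close>, and \<open>3 = 0\<close> in it.\<close>

abbreviation eps :: "3 \<Rightarrow> nat ^ 3"
  where "eps j \<equiv> axis j 1"

end

theory Submission
  imports Defs
begin

text \<open>
  Each \<open>T j\<close> is a weighted shift with weights of modulus at most \<open>1\<close>, so it is a contraction. It
  vanishes except on the vectors of degree \<open>1\<close>, which it sends to degree \<open>2\<close>. Hence all
  products \<open>T i \<circ> T j\<close> are zero, and in particular the operators commute.

  The obstruction to a dilation is that the weights have modulus exactly \<open>1\<close> off the diagonal. If
  \<open>U\<close> dilates \<open>T\<close> (along the embedding \<open>V\<close>), then \<open>V (T j h)\<close> is the orthogonal projection of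
  \<open>U j (V h)\<close>. When \<open>T j\<close> preserves the norm of \<open>h\<close>, nothing is lost under the projection, and
  \<open>U j (V h) = V (T j h)\<close>; this is the content of \<open>dilation_eq_on_norm_preserved\<close>. With
  \<open>f i = V (e (eps i))\<close> it gives \<open>U 2 (f 1) = - U 1 (f 2)\<close>, \<open>U 3 (f 1) = U 1 (f 3)\<close> and
  \<open>U 3 (f 2) = U 2 (f 3)\<close>, so by commutativity
  \<open>U 2 (U 3 (f 1)) = U 2 (U 1 (f 3)) = U 1 (U 2 (f 3)) = U 1 (U 3 (f 2)) = U 3 (U 1 (f 2))
    = - U 3 (U 2 (f 1)) = - U 2 (U 3 (f 1))\<close>.
  Thus \<open>U 2 (U 3 (f 1)) = 0\<close>, although \<open>U 2\<close> and \<open>U 3\<close> are isometric and \<open>f 1\<close> is a unit vector.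
  The single sign \<open>a 2 1 = -1\<close> makes the three relations incompatible.
\<close>

section \<open>Complex inner product spaces\<close>

lemma module_scaleC: "module ((*\<^sub>C) :: complex \<Rightarrow> 'a::complex_inner \<Rightarrow> 'a)"
  by standard (simp_all add: scaleC_add_right scaleC_add_left scaleC_scaleC
      scaleC_of_real[of 1, simplified])

lemmas scaleC_zero_left = module.scale_zero_left[OF module_scaleC]
  and scaleC_zero_right = module.scale_zero_right[OF module_scaleC]
  and scaleC_minus_left = module.scale_minus_left[OF module_scaleC]

lemma scaleC_one: "1 *\<^sub>C x = (x::'a::complex_inner)"
  using scaleC_of_real[of 1 x] by simp

lemma cinner_zero_left: "cinner 0 x = 0"
  using cinner_add_left[of 0 0 x] by simp

lemma cinner_sum_left: "cinner (\<Sum>i\<in>A. f i) x = (\<Sum>i\<in>A. cinner (f i) x)"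
  by (induction A rule: infinite_finite_induct) (simp_all add: cinner_zero_left cinner_add_left)

lemma cinner_add_right: "cinner x (y + z) = cinner x y + cinner x z"
  by (metis cinner_add_left cinner_commute complex_cnj_add)

lemma cinner_sum_right: "cinner x (\<Sum>i\<in>A. f i) = (\<Sum>i\<in>A. cinner x (f i))"
  by (subst cinner_commute) (simp add: cinner_sum_left cinner_commute[of x])

lemma cinner_scaleC_right: "cinner x (c *\<^sub>C y) = cnj c * cinner x y"
  by (metis cinner_commute cinner_scaleC_left complex_cnj_mult)

lemma norm_eqI_cinner:
  assumes "cinner x x = cinner y y"
  shows "norm x = norm y"
proof -
  have "(norm x)\<^sup>2 = (norm y)\<^sup>2"
    using assms unfolding cinner_self of_real_eq_iff .
  then show ?thesis
    by simp
qed

lemma norm_power2_add_orthogonal: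
  assumes "cinner x y = 0"
  shows "(norm (x + y))\<^sup>2 = (norm x)\<^sup>2 + (norm y)\<^sup>2"
proof -
  have "cinner y x = 0"
    using assms cinner_commute[of y x] by simp
  then have "cinner (x + y) (x + y) = cinner x x + cinner y y"
    using assms by (simp add: cinner_add_left cinner_add_right)
  then show ?thesis
    unfolding cinner_self of_real_add[symmetric] of_real_eq_iff .
qed

lemma norm_power2_orthonormal_sum:
  assumes orth: "\<And>i j. cinner (f i) (f j) = (if i = j then 1 else 0)"
    and "finite A"
  shows "(norm (\<Sum>i\<in>A. c i *\<^sub>C f i))\<^sup>2 = (\<Sum>i\<in>A. (cmod (c i))\<^sup>2)"
proof -
  have "cinner (\<Sum>i\<in>A. c i *\<^sub>C f i) (\<Sum>i\<in>A. c i *\<^sub>C f i)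
      = (\<Sum>i\<in>A. \<Sum>j\<in>A. cnj (c i) * (c j * (if j = i then 1 else 0)))"
    by (simp add: cinner_sum_left cinner_sum_right cinner_scaleC_left cinner_scaleC_right orth
        sum_distrib_left)
  also have "\<dots> = (\<Sum>i\<in>A. c i * cnj (c i))"
    using \<open>finite A\<close> by (simp add: if_distrib[of "(*) _"] mult.commute cong: if_cong)
  also have "\<dots> = complex_of_real (\<Sum>i\<in>A. (cmod (c i))\<^sup>2)"
    by (simp only: complex_norm_square of_real_sum)
  finally show ?thesis
    unfolding cinner_self of_real_eq_iff .
qed

text \<open>By Pythagoras, an orthogonal projection shortens every vector outside its range.\<close>

lemma orthogonal_projection_norm_eq:
  assumes "orthogonal_projection_onto M P" and "norm (P x) = norm x"
  shows "P x = x"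
proof -
  have "cinner (x - P x) (P x) = 0"
    using assms(1) by (simp add: orthogonal_projection_onto_def)
  from norm_power2_add_orthogonal[OF this] assms(2) show ?thesis
    by simp
qed

section \<open>Operators given on an orthonormal basis\<close>

lemma bounded_clinear_sum:
  assumes "bounded_clinear S"
  shows "S (\<Sum>i\<in>A. c i *\<^sub>C f i) = (\<Sum>i\<in>A. c i *\<^sub>C S (f i))"
proof -
  have "bounded_linear S" "\<And>c x. S (c *\<^sub>C x) = c *\<^sub>C S x"
    using assms by (auto simp: bounded_clinear_def)
  then show ?thesis
    by (simp add: linear_sum[OF bounded_linear.linear])
qed

lemma orthonormal_basis_closed_induct:
  fixes e :: "'i \<Rightarrow> 'a::complex_inner"
  assumes e: "orthonormal_basis e"
    and closed: "closed {x. Q x}"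
    and fin: "\<And>A c. finite A \<Longrightarrow> Q (\<Sum>i\<in>A. c i *\<^sub>C e i)"
  shows "Q x"
proof -
  have "module.span (*\<^sub>C) (range e) \<subseteq> {x. Q x}"
  proof
    fix y assume "y \<in> module.span (*\<^sub>C) (range e)"
    then obtain B r where B: "finite B" "B \<subseteq> range e" and y: "y = (\<Sum>b\<in>B. r b *\<^sub>C b)"
      unfolding module.span_explicit[OF module_scaleC] by auto
    from B(2) obtain A where A: "inj_on e A" "B = e ` A"
      by (auto simp: subset_image_inj)
    have "y = (\<Sum>i\<in>A. r (e i) *\<^sub>C e i)"
      unfolding y A(2) by (simp add: sum.reindex[OF A(1)])
    moreover have "finite A"
      using B(1) A by (simp add: finite_image_iff)
    ultimately show "y \<in> {x. Q x}"
      using fin by simp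
  qed
  then have "closure (module.span (*\<^sub>C) (range e)) \<subseteq> {x. Q x}"
    by (rule closure_minimal[OF _ closed])
  then show ?thesis
    using e by (auto simp: orthonormal_basis_def)
qed

lemma bounded_clinear_zero_on_basis:
  assumes e: "orthonormal_basis e"
    and S: "bounded_clinear S"
    and zero: "\<And>i. S (e i) = 0"
  shows "S x = 0"
proof (rule orthonormal_basis_closed_induct[OF e])
  have "continuous_on UNIV S"
    using S by (simp add: bounded_clinear_def linear_continuous_on)
  then show "closed {x. S x = 0}"
    by (intro closed_Collect_eq continuous_intros)
qed (simp add: bounded_clinear_sum[OF S] zero scaleC_zero_right)

text \<open>Both \<open>e\<close> and \<open>e \<circ> s\<close> are orthonormal families, so on finite linear combinations of the basis
  both norms are given by the coefficients; the bound extends by density.\<close>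

lemma weighted_shift_contraction:
  fixes e :: "'i \<Rightarrow> 'a::complex_inner"
  assumes e: "orthonormal_basis e"
    and S: "bounded_clinear S"
    and shift: "\<And>i. S (e i) = v i *\<^sub>C e (s i)"
    and "inj s"
    and v: "\<And>i. cmod (v i) \<le> 1"
  shows "contraction S"
proof -
  have orth: "cinner (e i) (e j) = (if i = j then 1 else 0)" for i j
    using e by (simp add: orthonormal_basis_def)
  have orth_s: "cinner (e (s i)) (e (s j)) = (if i = j then 1 else 0)" for i j
    using \<open>inj s\<close> by (simp add: orth inj_eq)
  have "norm (S x) \<le> norm x" for x
  proof (rule orthonormal_basis_closed_induct[OF e])
    have "continuous_on UNIV S"
      using S by (simp add: bounded_clinear_def linear_continuous_on)
    then show "closed {x. norm (S x) \<le> norm x}"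
      by (intro closed_Collect_le continuous_intros)
  next
    fix A :: "'i set" and c assume "finite A"
    have "S (\<Sum>i\<in>A. c i *\<^sub>C e i) = (\<Sum>i\<in>A. (c i * v i) *\<^sub>C e (s i))"
      by (simp add: bounded_clinear_sum[OF S] shift scaleC_scaleC)
    then have "(norm (S (\<Sum>i\<in>A. c i *\<^sub>C e i)))\<^sup>2 = (\<Sum>i\<in>A. (cmod (c i * v i))\<^sup>2)"
      using norm_power2_orthonormal_sum[OF orth_s \<open>finite A\<close>] by simp
    also have "\<dots> \<le> (\<Sum>i\<in>A. (cmod (c i))\<^sup>2)"
      by (intro sum_mono power_mono) (simp_all add: norm_mult mult_left_le v)
    also have "\<dots> = (norm (\<Sum>i\<in>A. c i *\<^sub>C e i))\<^sup>2"
      using norm_power2_orthonormal_sum[OF orth \<open>finite A\<close>] by simp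
    finally show "norm (S (\<Sum>i\<in>A. c i *\<^sub>C e i)) \<le> norm (\<Sum>i\<in>A. c i *\<^sub>C e i)"
      by (rule power2_le_imp_le) simp
  qed
  then have "onorm S \<le> 1"
    by (intro onorm_bound) simp_all
  with S show ?thesis
    by (simp add: contraction_def)
qed

section \<open>Unitary dilations\<close>

lemma monomial_op_axis: "monomial_op T (axis j 1) = T j"
proof -
  have "foldr (\<lambda>i S. (T i ^^ (axis j 1 $ i)) \<circ> S) xs id = (if j \<in> set xs then T j else id)"
    if "distinct xs" for xs
    using that by (induction xs) (auto simp: axis_def fun_eq_iff)
  from this[of "sorted_list_of_set UNIV"] show ?thesis
    by (simp add: monomial_op_def)
qed

lemma poly_op_variable: "poly_op (Poly_Mapping.single (axis j 1) 1) T x = T j x"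
  by (simp add: poly_op_def monomial_op_axis scaleC_one del: One_nat_def)

text \<open>Since \<open>V (T j h)\<close> is the projection of \<open>U j (V h)\<close>, and both have the norm of \<open>h\<close>, the
  projection does not move \<open>U j (V h)\<close>.\<close>

lemma dilation_eq_on_norm_preserved:
  assumes V: "isometric_embedding V"
    and P: "orthogonal_projection_onto (range V) P"
    and U: "unitary (U j)"
    and dil: "\<And>p h. V (poly_op p T h) = P (poly_op p U (V h))"
    and norm: "norm (T j h) = norm h"
  shows "U j (V h) = V (T j h)"
proof -
  have PU: "V (T j h) = P (U j (V h))"
    using dil[of "Poly_Mapping.single (axis j 1) 1" h] by (simp only: poly_op_variable)
  have norm_V: "norm (V x) = norm x" for x
    using V by (intro norm_eqI_cinner) (simp add: isometric_embedding_def)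
  have "norm (U j (V h)) = norm (V h)"
    using U by (intro norm_eqI_cinner) (simp add: unitary_def)
  then have "norm (P (U j (V h))) = norm (U j (V h))"
    using norm by (simp add: PU[symmetric] norm_V)
  from orthogonal_projection_norm_eq[OF P this] show ?thesis
    by (simp add: PU)
qed

text \<open>The sign: applying \<open>B\<close> to \<open>C x = A z\<close> and commuting leads around a cycle back to
  \<open>- B (C x)\<close>.\<close>

lemma sign_cycle_zero:
  fixes A B C :: "'a::real_normed_vector \<Rightarrow> 'a"
  assumes "linear C"
    and comm: "A \<circ> B = B \<circ> A" "A \<circ> C = C \<circ> A" "B \<circ> C = C \<circ> B"
    and rel: "B x = - A y" "C x = A z" "C y = B z"
  shows "B (C x) = 0"
proof -
  have comm': "A (B u) = B (A u)" "A (C u) = C (A u)" "B (C u) = C (B u)" for u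
    using comm by (auto simp: fun_eq_iff)
  have "B (C x) = A (C y)"
    by (simp add: rel comm'(1))
  also have "\<dots> = C (- B x)"
    using rel(1) by (simp add: comm'(2))
  also have "\<dots> = - B (C x)"
    by (simp add: linear_neg[OF \<open>linear C\<close>] comm'(3))
  finally have "2 *\<^sub>R B (C x) = 0"
    by (simp only: scaleR_2 eq_neg_iff_add_eq_0)
  then show ?thesis
    by simp
qed

section \<open>The three weighted shifts\<close>

lemma eps_add_eps_neq_eps:
  assumes "i \<noteq> j"
  shows "eps i + eps j \<noteq> eps k"
proof
  assume eq: "eps i + eps j = eps k"
  from eq have "(eps i + eps j) $ i = eps k $ i" "(eps i + eps j) $ j = eps k $ j"
    by simp_all
  with assms show False
    by (auto simp: axis_def split: if_splits)
qed

theorem mainTheorem2: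
  fixes e :: "nat ^ 3 \<Rightarrow> 'h::chilbert_space"
    and a :: "3 \<Rightarrow> 3 \<Rightarrow> complex"
    and w :: "nat ^ 3 \<Rightarrow> 3 \<Rightarrow> complex"
    and T :: "3 \<Rightarrow> 'h \<Rightarrow> 'h"
  assumes "orthonormal_basis e"
    and "a 2 1 = -1"
    and "a 1 2 = 1" "a 1 3 = 1" "a 2 3 = 1" "a 3 1 = 1" "a 3 2 = 1"
    and "\<And>i j. i \<noteq> j \<Longrightarrow> w (eps i) j = a i j"
    and "\<And>I j. \<nexists>i. i \<noteq> j \<and> I = eps i \<Longrightarrow> w I j = 0"
    and "\<And>j. bounded_clinear (T j)"
    and "\<And>I j. T j (e I) = w I j *\<^sub>C e (I + eps j)"
  shows "(\<forall>j. contraction (T j)) \<and> commuting T \<and>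
    \<not> dilates_to_commuting_unitaries TYPE('k::chilbert_space) T"
proof (intro conjI allI)
  note a = assms(2-7) and w_eps = assms(8) and w_zero = assms(9)
    and T_lin = assms(10) and T_e = assms(11)
  have orth: "cinner (e I) (e J) = (if I = J then 1 else 0)" for I J
    using assms(1) by (simp add: orthonormal_basis_def)
  have a_cases: "a i j = 1 \<or> a i j = -1" if "i \<noteq> j" for i j
    using that a exhaust_3[of i] exhaust_3[of j] by auto
  have w_le: "cmod (w I j) \<le> 1" for I j
  proof (cases "\<exists>i. i \<noteq> j \<and> I = eps i")
    case True
    then obtain i where i: "i \<noteq> j" and I: "I = eps i"
      by blast
    show ?thesis
      unfolding I w_eps[OF i] using a_cases[OF i] by auto
  qed (simp add: w_zero)
  show "contraction (T j)" for j
    by (rule weighted_shift_contraction[OF assms(1) T_lin, where v = "\<lambda>I. w I j"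
          and s = "\<lambda>I. I + eps j"]) (simp_all only: T_e w_le inj_on_def add_right_cancel simp_thms ball_simps)

  have TT_e: "T i (T j (e I)) = 0" for i j I
  proof -
    have "w (I + eps j) i * w I j = 0"
    proof (cases "\<exists>k. k \<noteq> j \<and> I = eps k")
      case True
      then have "w (I + eps j) i = 0"
        using eps_add_eps_neq_eps by (intro w_zero) metis
      then show ?thesis
        by simp
    qed (simp add: w_zero)
    moreover have "T i (T j (e I)) = (w (I + eps j) i * w I j) *\<^sub>C e (I + eps j + eps i)"
      using T_lin[of i] by (simp add: bounded_clinear_def T_e scaleC_scaleC mult.commute)
    ultimately show ?thesis
      by (simp only: scaleC_zero_left)
  qed
  have TT: "T i (T j x) = 0" for i j x
  proof (rule bounded_clinear_zero_on_basis[OF assms(1), of "\<lambda>x. T i (T j x)"])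
    show "bounded_clinear (\<lambda>x. T i (T j x))"
      using T_lin by (auto simp: bounded_clinear_def intro: bounded_linear_compose)
  qed (rule TT_e)
  show "commuting T"
    by (simp add: commuting_def fun_eq_iff TT)

  show "\<not> dilates_to_commuting_unitaries TYPE('k) T"
  proof
    assume "dilates_to_commuting_unitaries TYPE('k) T"
    then obtain V :: "'h \<Rightarrow> 'k" and P U
      where V: "isometric_embedding V" and P: "orthogonal_projection_onto (range V) P"
        and U: "\<And>j. unitary (U j)" and comm: "commuting U"
        and dil: "\<And>p h. V (poly_op p T h) = P (poly_op p U (V h))"
      unfolding dilates_to_commuting_unitaries_def by blast
    have V_scale: "V (c *\<^sub>C x) = c *\<^sub>C V x" for c x
      using V by (simp add: isometric_embedding_def bounded_clinear_def)
    have norm_e: "norm (e I) = 1" for I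
    proof -
      have "cinner (e I) (e I) = cinner (1::complex) 1"
        by (simp add: orth cinner_complex_def)
      from norm_eqI_cinner[OF this] show ?thesis
        by simp
    qed
    have U_f: "U j (V (e (eps i))) = a i j *\<^sub>C V (e (eps i + eps j))" if "i \<noteq> j" for i j
    proof -
      have T_f: "T j (e (eps i)) = a i j *\<^sub>C e (eps i + eps j)"
        by (simp only: T_e w_eps[OF that])
      have "norm (T j (e (eps i))) = norm (e (eps i))"
        unfolding T_f using a_cases[OF that] by (auto simp: norm_e scaleC_one scaleC_minus_left)
      from dilation_eq_on_norm_preserved[OF V P U dil this] show ?thesis
        by (simp only: T_f V_scale)
    qed
    define f where "f i = V (e (eps i))" for i
    have "U 2 (f 1) = - U 1 (f 2)" "U 3 (f 1) = U 1 (f 3)" "U 3 (f 2) = U 2 (f 3)"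
      by (simp_all add: f_def U_f a scaleC_one scaleC_minus_left add.commute del: One_nat_def)
    then have "U 2 (U 3 (f 1)) = 0"
      using comm U
      by (intro sign_cycle_zero[where A = "U 1" and B = "U 2" and C = "U 3"])
        (auto simp: commuting_def unitary_def bounded_clinear_def bounded_linear.linear)
    moreover have "cinner (U 2 (U 3 (f 1))) (U 2 (U 3 (f 1))) = 1"
      using U V by (simp add: f_def unitary_def isometric_embedding_def orth)
    ultimately show False
      by (simp add: cinner_zero_left)
  qed
qed

end
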